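(* Let $k,\ell$ be kernels on a non-empty set $X$. If $(k,\ell)$ has a strong Shimorin certificate, then it also has a Shimorin certificate.
   Context: A kernel on a non-empty set $X$ is a function $k:X\times X\to\mathbb{C}$ such that $[k(z_i,z_j)]_{i,j=1}^n$ is positive semi-definite for all finite choices of points; $k_1\succeq k_2$ (or $k_2\preceq k_1$) means $k_1-k_2$ is a kernel; $\mathcal{H}_k$ is the reproducing kernel Hilbert space. Standing assumption: $k(x,x)\ne0\ne\ell(x,x)$ for all $x\in X$. For $z\in X$, $k^z(w,v)=k(w,v)-\frac{k(w,z)k(z,v)}{k(z,z)}$, and similarly $\ell^z$. A Shimorin certificate for $(k,\ell)$ is a family of kernels $\{p[z]\}_{z\in X}$ on $X$ such that $\ell^z\succeq p[z]\ell$ and $k^z\preceq p[z]k$ for every $z\in X$ (pointwise products; the $p[z]$ may vanish on the diagonal). A strong Shimorin certificate for $(k,\ell)$ is a complete Pick kernel $s$ on $X$ for which there are kernels $h,g$ on $X$ with $k=(1-h)s$ and $\ell=sg$. A kernel $s$ on $X$ is a complete Pick kernel if for all $n,N\ge1$, all $z_1,\dots,z_n\in X$ and all complex $N\times N$ matrices $W_1,\dots,W_n$ with $[s(z_i,z_j)(I_{N\times N}-W_iW_j^* )]_{i,j=1}^n$ positive semi-definite, there is a function $\Phi:X\to\mathbb{M}_N$ (complex $N\times N$ matrices) which multiplies $\mathcal{H}_s\otimes\mathbb{C}^N$ into itself with multiplication operator of norm at most one and satisfies $\Phi(z_i)=W_i$ for all $i$. *)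

theory Defs
  imports Complex_Main "Jordan_Normal_Form.Schur_Decomposition"
begin

text \<open>Matrices are indexed by an arbitrary finite set, so that block matrices can be indexed by
  pairs. The order on the complex numbers is the one of \<open>HOL-Library.Complex_Order\<close>:
  \<open>0 \<le> z\<close> says that \<open>z\<close> is real and nonnegative.\<close>

definition psd :: "'i set \<Rightarrow> ('i \<Rightarrow> 'i \<Rightarrow> complex) \<Rightarrow> bool" where
  "psd I A \<longleftrightarrow> (\<forall>c :: 'i \<Rightarrow> complex. 0 \<le> (\<Sum>i\<in>I. \<Sum>j\<in>I. cnj (c i) * A i j * c j))"

definition pd_kernel :: "'a set \<Rightarrow> ('a \<Rightarrow> 'a \<Rightarrow> complex) \<Rightarrow> bool" where
  "pd_kernel X k \<longleftrightarrow>
     (\<forall>(n :: nat) z. (\<forall>i<n. z i \<in> X) \<longrightarrow> psd {..<n} (\<lambda>i j. k (z i) (z j)))"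

definition kernel_le :: "'a set \<Rightarrow> ('a \<Rightarrow> 'a \<Rightarrow> complex) \<Rightarrow> ('a \<Rightarrow> 'a \<Rightarrow> complex) \<Rightarrow> bool" where
  "kernel_le X k\<^sub>1 k\<^sub>2 \<longleftrightarrow> pd_kernel X (\<lambda>w v. k\<^sub>2 w v - k\<^sub>1 w v)"

definition kernel_at :: "('a \<Rightarrow> 'a \<Rightarrow> complex) \<Rightarrow> 'a \<Rightarrow> 'a \<Rightarrow> 'a \<Rightarrow> complex" where
  "kernel_at k z w v = k w v - k w z * k z v / k z z"

text \<open>A function on \<open>X\<close> is represented by its extension by zero to the whole type. A Hilbert
  space of functions is given by its carrier \<open>H\<close> and an inner product \<open>ip\<close>, linear in the first
  argument; the values of \<open>ip\<close> off \<open>H\<close> are irrelevant.\<close>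

definition ip_norm :: "(('a \<Rightarrow> complex) \<Rightarrow> ('a \<Rightarrow> complex) \<Rightarrow> complex) \<Rightarrow> ('a \<Rightarrow> complex) \<Rightarrow> real" where
  "ip_norm ip f = sqrt (Re (ip f f))"

locale hilbert_function_space =
  fixes X :: "'a set"
    and H :: "('a \<Rightarrow> complex) set"
    and ip :: "('a \<Rightarrow> complex) \<Rightarrow> ('a \<Rightarrow> complex) \<Rightarrow> complex"
  assumes support: "f \<in> H \<Longrightarrow> x \<notin> X \<Longrightarrow> f x = 0"
    and zero_mem: "(\<lambda>x. 0) \<in> H"
    and add_mem: "f \<in> H \<Longrightarrow> g \<in> H \<Longrightarrow> (\<lambda>x. f x + g x) \<in> H"
    and scale_mem: "f \<in> H \<Longrightarrow> (\<lambda>x. c * f x) \<in> H"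
    and ip_add: "f \<in> H \<Longrightarrow> g \<in> H \<Longrightarrow> u \<in> H \<Longrightarrow> ip (\<lambda>x. f x + g x) u = ip f u + ip g u"
    and ip_scale: "f \<in> H \<Longrightarrow> u \<in> H \<Longrightarrow> ip (\<lambda>x. c * f x) u = c * ip f u"
    and ip_cnj: "f \<in> H \<Longrightarrow> g \<in> H \<Longrightarrow> ip g f = cnj (ip f g)"
    and ip_nonneg: "f \<in> H \<Longrightarrow> 0 \<le> ip f f"
    and ip_definite: "f \<in> H \<Longrightarrow> ip f f = 0 \<Longrightarrow> f = (\<lambda>x. 0)"
    and complete:
      "(\<And>n :: nat. F n \<in> H) \<Longrightarrow>
       (\<And>e. 0 < e \<Longrightarrow> \<exists>M. \<forall>m\<ge>M. \<forall>n\<ge>M. ip_norm ip (\<lambda>x. F m x - F n x) < e) \<Longrightarrow>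
       \<exists>f\<in>H. (\<lambda>n. ip_norm ip (\<lambda>x. F n x - f x)) \<longlonglongrightarrow> 0"

definition kernel_section :: "'a set \<Rightarrow> ('a \<Rightarrow> 'a \<Rightarrow> complex) \<Rightarrow> 'a \<Rightarrow> 'a \<Rightarrow> complex" where
  "kernel_section X k z = (\<lambda>w. if w \<in> X then k w z else 0)"

text \<open>For a given kernel, \<open>H\<close> exists and is unique, and so is \<open>ip\<close> on \<open>H\<close> (Moore--Aronszajn).\<close>

definition is_rkhs ::
  "'a set \<Rightarrow> ('a \<Rightarrow> 'a \<Rightarrow> complex) \<Rightarrow> ('a \<Rightarrow> complex) set
    \<Rightarrow> (('a \<Rightarrow> complex) \<Rightarrow> ('a \<Rightarrow> complex) \<Rightarrow> complex) \<Rightarrow> bool" where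
  "is_rkhs X k H ip \<longleftrightarrow>
     hilbert_function_space X H ip \<and>
     (\<forall>z\<in>X. kernel_section X k z \<in> H \<and> (\<forall>f\<in>H. f z = ip f (kernel_section X k z)))"

text \<open>The Hilbert space tensor product of \<open>H\<close> with \<open>\<complex>\<^sup>N\<close>, realised in the usual way as the space
  of \<open>\<complex>\<^sup>N\<close>-valued functions with coordinates in \<open>H\<close>, the squared norm being the sum of the squared
  norms of the coordinates.\<close>

definition vec_space :: "nat \<Rightarrow> ('a \<Rightarrow> complex) set \<Rightarrow> ('a \<Rightarrow> complex vec) set" where
  "vec_space N H = {F. (\<forall>x. F x \<in> carrier_vec N) \<and> (\<forall>i<N. (\<lambda>x. F x $ i) \<in> H)}"

definition vec_norm ::
  "nat \<Rightarrow> (('a \<Rightarrow> complex) \<Rightarrow> ('a \<Rightarrow> complex) \<Rightarrow> complex) \<Rightarrow> ('a \<Rightarrow> complex vec) \<Rightarrow> real" where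
  "vec_norm N ip F = sqrt (\<Sum>i<N. (ip_norm ip (\<lambda>x. F x $ i))\<^sup>2)"

definition multiply ::
  "'a set \<Rightarrow> nat \<Rightarrow> ('a \<Rightarrow> complex mat) \<Rightarrow> ('a \<Rightarrow> complex vec) \<Rightarrow> 'a \<Rightarrow> complex vec" where
  "multiply X N \<Phi> F = (\<lambda>x. if x \<in> X then \<Phi> x *\<^sub>v F x else 0\<^sub>v N)"

definition contractive_multiplier ::
  "'a set \<Rightarrow> ('a \<Rightarrow> 'a \<Rightarrow> complex) \<Rightarrow> nat \<Rightarrow> ('a \<Rightarrow> complex mat) \<Rightarrow> bool" where
  "contractive_multiplier X s N \<Phi> \<longleftrightarrow>
     (\<forall>x\<in>X. \<Phi> x \<in> carrier_mat N N) \<and>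
     (\<exists>H ip. is_rkhs X s H ip \<and>
        (\<forall>F\<in>vec_space N H.
           multiply X N \<Phi> F \<in> vec_space N H \<and>
           vec_norm N ip (multiply X N \<Phi> F) \<le> vec_norm N ip F))"

text \<open>The block matrix with \<open>N \<times> N\<close> blocks \<open>s (z i) (z j) (1 - W i (W j)\<^sup>*)\<close> is indexed by
  pairs (block index, index inside the block).\<close>

definition complete_pick :: "'a set \<Rightarrow> ('a \<Rightarrow> 'a \<Rightarrow> complex) \<Rightarrow> bool" where
  "complete_pick X s \<longleftrightarrow>
     pd_kernel X s \<and>
     (\<forall>n\<ge>1. \<forall>N\<ge>1. \<forall>(z :: nat \<Rightarrow> 'a) (W :: nat \<Rightarrow> complex mat).
        (\<forall>i<n. z i \<in> X) \<longrightarrow>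
        (\<forall>i<n. W i \<in> carrier_mat N N) \<longrightarrow>
        psd ({..<n} \<times> {..<N})
          (\<lambda>(i, a) (j, b). s (z i) (z j) * (1\<^sub>m N - W i * mat_adjoint (W j)) $$ (a, b)) \<longrightarrow>
        (\<exists>\<Phi>. contractive_multiplier X s N \<Phi> \<and> (\<forall>i<n. \<Phi> (z i) = W i)))"

definition shimorin_certificate ::
  "'a set \<Rightarrow> ('a \<Rightarrow> 'a \<Rightarrow> complex) \<Rightarrow> ('a \<Rightarrow> 'a \<Rightarrow> complex)
    \<Rightarrow> ('a \<Rightarrow> 'a \<Rightarrow> 'a \<Rightarrow> complex) \<Rightarrow> bool" where
  "shimorin_certificate X k l p \<longleftrightarrow>
     (\<forall>z\<in>X. pd_kernel X (p z) \<and>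
            kernel_le X (\<lambda>w v. p z w v * l w v) (kernel_at l z) \<and>
            kernel_le X (kernel_at k z) (\<lambda>w v. p z w v * k w v))"

definition strong_shimorin_certificate ::
  "'a set \<Rightarrow> ('a \<Rightarrow> 'a \<Rightarrow> complex) \<Rightarrow> ('a \<Rightarrow> 'a \<Rightarrow> complex)
    \<Rightarrow> ('a \<Rightarrow> 'a \<Rightarrow> complex) \<Rightarrow> bool" where
  "strong_shimorin_certificate X k l s \<longleftrightarrow>
     complete_pick X s \<and>
     (\<exists>h g. pd_kernel X h \<and> pd_kernel X g \<and>
        (\<forall>w\<in>X. \<forall>v\<in>X. k w v = (1 - h w v) * s w v \<and> l w v = s w v * g w v))"

end

theory Submission
  imports Defs
begin

text \<open>
  Let \<open>s\<close> be the complete Pick kernel of the strong certificate, so \<open>k = (1 - h) s\<close> and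
  \<open>l = s g\<close>. The certificate is \<open>p[z] = s\<^sup>z / s\<close>, where \<open>0 / 0 = 0\<close>.

  That \<open>p[z]\<close> is a kernel is the necessity half of the McCullough--Quiggin theorem.
  A contractive row multiplier \<open>\<phi>\<close> makes
  \<open>s (1 - \<phi> \<phi>\<^sup>*)\<close> a kernel (\<open>contractive_multiplier_row_psd\<close>), and then
  \<open>s\<^sup>z (1 - \<phi> \<phi>\<^sup>*)\<close> is a kernel as well, because the functions that vanish at \<open>z\<close> are
  mapped to functions that vanish at \<open>z\<close> (\<open>kernel_at_row_psd\<close>). The Pick property says that
  rows \<open>w\<close> given on a finite set \<open>S\<close> extend to such a \<open>\<phi>\<close>, so on \<open>S\<close> positivity of
  \<open>s (1 - w w\<^sup>*)\<close> implies positivity of \<open>s\<^sup>z (1 - w w\<^sup>*)\<close>, for every \<open>z\<close>. Now argue by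
  induction on \<open>S\<close>. For \<open>y \<in> S\<close> the row and the column of \<open>y\<close> in \<open>s\<^sup>y / s\<close> vanish, so
  \<open>s\<^sup>y / s\<close> is positive on \<open>S\<close> by the induction hypothesis for \<open>S - {y}\<close>, and it has the form
  \<open>w w\<^sup>*\<close>. If \<open>s\<close> has no zero on \<open>S \<times> S\<close>, then
  \<open>1 - w w\<^sup>* = s(\<cdot>,y) s(y,\<cdot>) / (s(y,y) s)\<close>, so \<open>s (1 - w w\<^sup>*)\<close> has rank one and is positive;
  hence \<open>s\<^sup>z s(\<cdot>,y) s(y,\<cdot>) / s\<close> is positive, and dividing by the rank one factor gives the
  claim. Zeros of \<open>s\<close> are harmless because \<open>s(x,y) \<noteq> 0\<close> is an equivalence relation
  (\<open>complete_pick_nonzero_trans\<close>), so the matrix splits into blocks.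

  The two comparisons follow by algebra, with the common rank one factor
  \<open>r = s(\<cdot>,z) s(z,\<cdot>) / s(z,z)\<close>: since \<open>p[z] s = s\<^sup>z\<close>, one finds \<open>l\<^sup>z - p[z] l = r g\<^sup>z\<close>
  and \<open>p[z] k - k\<^sup>z = r (h - 1 + (1 - h(\<cdot>,z)) (1 - h(z,\<cdot>)) / (1 - h(z,z)))\<close>. Here
  \<open>g\<^sup>z\<close> is a Schur complement, and the other cofactor is treated in
  \<open>kernel_complement_psd\<close>.
\<close>

section \<open>Positive semi-definite matrices\<close>

lemma psdD: "psd S A \<Longrightarrow> 0 \<le> (\<Sum>i\<in>S. \<Sum>j\<in>S. cnj (c i) * A i j * c j)"
  unfolding psd_def by blast

lemma psd_cong:
  assumes "\<And>i j. i \<in> S \<Longrightarrow> j \<in> S \<Longrightarrow> A i j = B i j"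
  shows "psd S A \<longleftrightarrow> psd S B"
  unfolding psd_def using assms by (simp cong: sum.cong)

lemma psd_subset:
  assumes "finite T" "S \<subseteq> T" "psd T A"
  shows "psd S A"
  unfolding psd_def
proof
  fix c :: "'a \<Rightarrow> complex"
  let ?d = "\<lambda>i. if i \<in> S then c i else 0"
  have inner: "(\<Sum>j\<in>T. cnj (?d i) * A i j * ?d j) = (\<Sum>j\<in>S. cnj (?d i) * A i j * c j)" for i
    using assms by (intro sum.mono_neutral_cong_right) auto
  have "(\<Sum>i\<in>T. \<Sum>j\<in>T. cnj (?d i) * A i j * ?d j) = (\<Sum>i\<in>S. \<Sum>j\<in>S. cnj (c i) * A i j * c j)"
    unfolding inner using assms by (intro sum.mono_neutral_cong_right) (auto intro: finite_subset)
  then show "0 \<le> (\<Sum>i\<in>S. \<Sum>j\<in>S. cnj (c i) * A i j * c j)"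
    using psdD[OF assms(3), of ?d] by simp
qed

lemma psd_add:
  assumes "psd S A" "psd S B"
  shows "psd S (\<lambda>i j. A i j + B i j)"
  unfolding psd_def using psdD[OF assms(1)] psdD[OF assms(2)]
  by (auto simp: distrib_left distrib_right sum.distrib intro: add_nonneg_nonneg)

lemma psd_sum:
  assumes "\<And>a. a \<in> M \<Longrightarrow> psd S (A a)"
  shows "psd S (\<lambda>i j. \<Sum>a\<in>M. A a i j)"
proof (cases "finite M")
  case True
  then show ?thesis using assms
  proof (induction M rule: finite_induct)
    case empty
    then show ?case by (simp add: psd_def)
  next
    case (insert a M)
    then show ?case by (simp add: psd_add)
  qed
qed (simp add: psd_def)

lemma psd_congruence:
  assumes "psd S A"
  shows "psd S (\<lambda>i j. f i * A i j * cnj (f j))"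
  unfolding psd_def
proof
  fix c :: "'a \<Rightarrow> complex"
  show "0 \<le> (\<Sum>i\<in>S. \<Sum>j\<in>S. cnj (c i) * (f i * A i j * cnj (f j)) * c j)"
    using psdD[OF assms, of "\<lambda>i. cnj (f i) * c i"] by (simp add: mult_ac)
qed

lemma psd_one: "psd S (\<lambda>i j. 1)"
  unfolding psd_def
proof
  fix c :: "'a \<Rightarrow> complex"
  have "(\<Sum>i\<in>S. \<Sum>j\<in>S. cnj (c i) * 1 * c j) = (\<Sum>i\<in>S. c i) * cnj (\<Sum>i\<in>S. c i)"
    by (simp add: sum_product mult.commute) (subst sum.swap, simp)
  then show "0 \<le> (\<Sum>i\<in>S. \<Sum>j\<in>S. cnj (c i) * 1 * c j)"
    by (simp only: complex_mult_cnj) (simp add: less_eq_complex_def)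
qed

lemma psd_rank_one: "psd S (\<lambda>i j. f i * cnj (f j))"
  using psd_congruence[OF psd_one, of S f] by simp

lemma psd_scale:
  assumes "psd S A" "0 \<le> r"
  shows "psd S (\<lambda>i j. A i j * complex_of_real r)"
  using psd_congruence[OF assms(1), of "\<lambda>_. complex_of_real (sqrt r)"] assms(2)
  by (simp add: mult_ac flip: of_real_mult)

text \<open>The map \<open>g\<close> may identify indices: coefficients of identified indices are added up.\<close>

lemma psd_comp:
  fixes g :: "'b \<Rightarrow> 'a"
  assumes "finite I" "psd (g ` I) A"
  shows "psd I (\<lambda>i j. A (g i) (g j))"
  unfolding psd_def
proof
  fix c :: "'b \<Rightarrow> complex"
  let ?d = "\<lambda>x. \<Sum>i\<in>{i\<in>I. g i = x}. c i"
  have R: "(\<Sum>j\<in>I. F (g j) * c j) = (\<Sum>y\<in>g`I. F y * ?d y)" for F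
    using sum.image_gen[OF assms(1), of "\<lambda>j. F (g j) * c j" g]
    by (simp add: sum_distrib_left)
  have L: "(\<Sum>j\<in>I. cnj (c j) * F (g j)) = (\<Sum>y\<in>g`I. cnj (?d y) * F y)" for F
    using sum.image_gen[OF assms(1), of "\<lambda>j. cnj (c j) * F (g j)" g]
    by (simp add: sum_distrib_right)
  have "(\<Sum>i\<in>I. \<Sum>j\<in>I. cnj (c i) * A (g i) (g j) * c j)
      = (\<Sum>i\<in>I. cnj (c i) * (\<Sum>j\<in>I. A (g i) (g j) * c j))"
    by (simp add: sum_distrib_left mult.assoc)
  also have "\<dots> = (\<Sum>i\<in>I. cnj (c i) * (\<Sum>y\<in>g`I. A (g i) y * ?d y))"
    using R by simp
  also have "\<dots> = (\<Sum>x\<in>g`I. cnj (?d x) * (\<Sum>y\<in>g`I. A x y * ?d y))"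
    by (rule L)
  also have "\<dots> = (\<Sum>x\<in>g`I. \<Sum>y\<in>g`I. cnj (?d x) * A x y * ?d y)"
    by (simp only: sum_distrib_left mult.assoc)
  finally show "0 \<le> (\<Sum>i\<in>I. \<Sum>j\<in>I. cnj (c i) * A (g i) (g j) * c j)"
    using psdD[OF assms(2), of ?d] by (simp only:)
qed

lemma psd_block_sum:
  assumes "finite M" "\<And>a. a \<in> M \<Longrightarrow> psd I (A a)"
  shows "psd (I \<times> M) (\<lambda>(i, a) (j, b). if a = b then A a i j else 0)"
  unfolding psd_def
proof
  fix c :: "'b \<times> 'a \<Rightarrow> complex"
  let ?G = "\<lambda>(i, a) (j, b). if a = b then A a i j else 0"
  have "(\<Sum>p\<in>I \<times> M. \<Sum>q\<in>I \<times> M. cnj (c p) * ?G p q * c q)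
      = (\<Sum>i\<in>I. \<Sum>a\<in>M. \<Sum>j\<in>I. \<Sum>b\<in>M. if b = a then cnj (c (i, a)) * A a i j * c (j, a) else 0)"
    by (simp add: sum.cartesian_product') (intro sum.cong refl, auto)
  also have "\<dots> = (\<Sum>i\<in>I. \<Sum>a\<in>M. \<Sum>j\<in>I. cnj (c (i, a)) * A a i j * c (j, a))"
    using assms(1) by (intro sum.cong refl) simp
  also have "\<dots> = (\<Sum>a\<in>M. \<Sum>i\<in>I. \<Sum>j\<in>I. cnj (c (i, a)) * A a i j * c (j, a))"
    by (rule sum.swap)
  finally show "0 \<le> (\<Sum>p\<in>I \<times> M. \<Sum>q\<in>I \<times> M. cnj (c p) * ?G p q * c q)"
    using psdD[OF assms(2), of _ "\<lambda>i. c (i, _)"] by (simp add: sum_nonneg)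
qed

lemma psd_image:
  assumes "inj_on g I" "psd I (\<lambda>i j. A (g i) (g j))"
  shows "psd (g ` I) A"
  unfolding psd_def
proof
  fix c
  show "0 \<le> (\<Sum>i\<in>g ` I. \<Sum>j\<in>g ` I. cnj (c i) * A i j * c j)"
    using psdD[OF assms(2), of "\<lambda>i. c (g i)"] by (simp add: sum.reindex[OF assms(1)])
qed

text \<open>Repeated points add no condition, so kernels can be tested on finite sets of points, which
  is the form suited to induction.\<close>

lemma pd_kernel_iff_finite: "pd_kernel X k \<longleftrightarrow> (\<forall>S. finite S \<longrightarrow> S \<subseteq> X \<longrightarrow> psd S k)"
proof (intro iffI allI impI)
  fix S assume k: "pd_kernel X k" and S: "finite S" "S \<subseteq> X"
  obtain g where g: "bij_betw g {0..<card S} S"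
    using ex_bij_betw_nat_finite[OF S(1)] by blast
  have im: "g ` {..<card S} = S" and inj: "inj_on g {..<card S}"
    using g unfolding bij_betw_def atLeast0LessThan by blast+
  have "psd {..<card S} (\<lambda>i j. k (g i) (g j))"
  proof (rule k[unfolded pd_kernel_def, rule_format])
    fix i assume "i < card S"
    then show "g i \<in> X" using im S(2) by blast
  qed
  from psd_image[OF inj this] show "psd S k" by (simp add: im)
next
  assume k: "\<forall>S. finite S \<longrightarrow> S \<subseteq> X \<longrightarrow> psd S k"
  show "pd_kernel X k"
    unfolding pd_kernel_def
  proof (intro allI impI)
    fix n :: nat and z assume z: "\<forall>i<n. z i \<in> X"
    show "psd {..<n} (\<lambda>i j. k (z i) (z j))"
      by (rule psd_comp, simp) (rule k[rule_format], use z in auto)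
  qed
qed

lemma pd_kernel_psd: "pd_kernel X k \<Longrightarrow> finite S \<Longrightarrow> S \<subseteq> X \<Longrightarrow> psd S k"
  by (simp add: pd_kernel_iff_finite)

text \<open>The expansion behind completing the square in the coordinate \<open>x\<close>.\<close>

lemma quadratic_form_shift:
  fixes A :: "'i \<Rightarrow> 'i \<Rightarrow> complex"
  assumes "finite S" "x \<in> S"
  shows "(\<Sum>i\<in>S. \<Sum>j\<in>S. cnj (c i + (if i = x then d else 0)) * A i j * (c j + (if j = x then d else 0)))
    = (\<Sum>i\<in>S. \<Sum>j\<in>S. cnj (c i) * A i j * c j)
      + cnj d * (\<Sum>j\<in>S. A x j * c j) + (\<Sum>i\<in>S. cnj (c i) * A i x) * d + cnj d * A x x * d"
proof -
  have "(\<Sum>j\<in>S. cnj (c i + (if i = x then d else 0)) * A i j * (c j + (if j = x then d else 0)))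
     = (\<Sum>j\<in>S. cnj (c i) * A i j * c j) + (if i = x then cnj d * (\<Sum>j\<in>S. A x j * c j) else 0)
       + cnj (c i) * A i x * d + (if i = x then cnj d * A x x * d else 0)" for i
  proof -
    have "(\<Sum>j\<in>S. e * A i j * (c j + (if j = x then d else 0)))
        = (\<Sum>j\<in>S. e * A i j * c j + (if j = x then e * A i x * d else 0))" for e
      by (rule sum.cong) (auto simp: distrib_left)
    then have "(\<Sum>j\<in>S. e * A i j * (c j + (if j = x then d else 0)))
        = e * (\<Sum>j\<in>S. A i j * c j) + e * A i x * d" for e
      using assms by (simp add: sum.distrib sum_distrib_left mult.assoc)
    then show ?thesis
      by (simp add: distrib_right) (simp add: sum_distrib_left mult.assoc)
  qed
  then show ?thesis
    using assms by (simp add: sum.distrib sum_distrib_right)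
qed

lemma psd_diag_nonneg:
  assumes "finite S" "psd S A" "x \<in> S"
  shows "0 \<le> A x x"
proof -
  have "psd {x} A" by (rule psd_subset[OF assms(1) _ assms(2)]) (use assms in simp)
  from psdD[OF this, of "\<lambda>_. 1"] show ?thesis by simp
qed

lemma psd_hermitian:
  assumes "finite S" "psd S A" "x \<in> S" "y \<in> S"
  shows "A y x = cnj (A x y)"
proof (cases "x = y")
  case True
  then show ?thesis using psd_diag_nonneg[OF assms(1,2,3)]
    by (auto simp: less_eq_complex_def complex_eq_iff)
next
  case False
  have P: "psd {x, y} A" by (rule psd_subset[OF assms(1) _ assms(2)]) (use assms in simp)
  have "0 \<le> A x x" "0 \<le> A y y"
    by (rule psd_diag_nonneg[OF _ P]; simp)+
  moreover have "0 \<le> A x x + A x y + (A y x + A y y)"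
    using psdD[OF P, of "\<lambda>i. 1"] False by (simp add: add_ac)
  moreover have "0 \<le> A x x + A x y * \<i> + (- \<i> * A y x + - \<i> * A y y * \<i>)"
    using psdD[OF P, of "\<lambda>i. if i = x then 1 else \<i>"] False by (simp add: algebra_simps)
  ultimately show ?thesis
    by (simp add: less_eq_complex_def complex_eq_iff)
qed

text \<open>For \<open>A x x \<noteq> 0\<close>, the value of \<open>kernel_at A x\<close> at \<open>c\<close> is the minimum of the quadratic
  form of \<open>A\<close> over all changes of the coordinate \<open>c x\<close>. For \<open>A x x = 0\<close> the convention
  \<open>u / 0 = 0\<close> gives \<open>kernel_at A x = A\<close>.\<close>

lemma psd_schur_complement:
  assumes fin: "finite S" and A: "psd S A" and x: "x \<in> S"
  shows "psd S (kernel_at A x)"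
proof (cases "A x x = 0")
  case True
  then show ?thesis using A by (simp add: kernel_at_def[abs_def])
next
  case False
  show ?thesis unfolding psd_def
  proof
    fix c
    define u where "u = (\<Sum>j\<in>S. A x j * c j)"
    \<comment> \<open>the minimising shift of the coordinate \<open>x\<close>\<close>
    define d where "d = - u / A x x"
    have xx: "cnj (A x x) = A x x" using psd_hermitian[OF fin A x x] by simp
    have u': "(\<Sum>i\<in>S. cnj (c i) * A i x) = cnj u"
      unfolding u_def using psd_hermitian[OF fin A x] by (simp add: mult.commute)
    have "(\<Sum>i\<in>S. \<Sum>j\<in>S. cnj (c i + (if i = x then d else 0)) * A i j * (c j + (if j = x then d else 0)))
        = (\<Sum>i\<in>S. \<Sum>j\<in>S. cnj (c i) * A i j * c j) - cnj u * u / A x x"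
      unfolding quadratic_form_shift[OF fin x] u' using False
      by (simp add: u_def[symmetric] d_def xx)
    also have "cnj u * u = (\<Sum>i\<in>S. cnj (c i) * A i x) * (\<Sum>j\<in>S. A x j * c j)"
      by (simp only: u' flip: u_def)
    also have "\<dots> = (\<Sum>i\<in>S. \<Sum>j\<in>S. cnj (c i) * A i x * (A x j * c j))"
      by (rule sum_product)
    also have "(\<Sum>i\<in>S. \<Sum>j\<in>S. cnj (c i) * A i j * c j) - \<dots> / A x x
      = (\<Sum>i\<in>S. \<Sum>j\<in>S. cnj (c i) * kernel_at A x i j * c j)"
      by (simp add: kernel_at_def sum_divide_distrib sum_subtractf[symmetric] algebra_simps)
    finally show "0 \<le> (\<Sum>i\<in>S. \<Sum>j\<in>S. cnj (c i) * kernel_at A x i j * c j)"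
      using psdD[OF A, of "\<lambda>i. c i + (if i = x then d else 0)"] by simp
  qed
qed

text \<open>Otherwise the form at \<open>- t * A x y\<close> in coordinate \<open>x\<close> and \<open>1\<close> in coordinate \<open>y\<close> is affine
  in \<open>t\<close> with negative slope.\<close>

lemma psd_diag_zero:
  assumes fin: "finite S" and A: "psd S A" and x: "x \<in> S" "y \<in> S" and 0: "A x x = 0"
  shows "A x y = 0"
proof -
  have P: "psd {x, y} A" by (rule psd_subset[OF fin _ A]) (use x in simp)
  have h: "A y x = cnj (A x y)" by (rule psd_hermitian[OF fin A x])
  have y0: "0 \<le> A y y" by (rule psd_diag_nonneg[OF fin A x(2)])
  show ?thesis
  proof (rule ccontr)
    assume n: "A x y \<noteq> 0"
    then have xy: "x \<noteq> y" using 0 by auto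
    define N where "N = (Re (A x y))\<^sup>2 + (Im (A x y))\<^sup>2"
    have N: "N \<noteq> 0" using n by (simp add: N_def complex_eq_iff)
    have "0 \<le> Re (A y y) - 2 * t * N" for t :: real
    proof -
      let ?d = "- complex_of_real t * A x y"
      have "0 \<le> cnj ?d * A x y + (A y x * ?d + A y y)"
        using psdD[OF P, of "\<lambda>i. if i = x then ?d else 1"] xy 0 by (simp add: add.assoc)
      then show ?thesis
        unfolding h by (simp add: less_eq_complex_def N_def power2_eq_square algebra_simps)
    qed
    from this[of "(Re (A y y) + 1) / N"] show False
      using N y0 by (simp add: less_eq_complex_def)
  qed
qed

text \<open>Cholesky decomposition: split off one index by a Schur complement, and record its column as
  a new last coordinate. The bound \<open>1 \<le> N\<close> is there because the Pick property concerns
  \<open>N \<times> N\<close> matrices with positive \<open>N\<close>.\<close>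

lemma psd_gram:
  fixes A :: "'i \<Rightarrow> 'i \<Rightarrow> complex"
  assumes "finite S" "psd S A"
  shows "\<exists>N\<ge>1. \<exists>w :: 'i \<Rightarrow> nat \<Rightarrow> complex. \<forall>i\<in>S. \<forall>j\<in>S. A i j = (\<Sum>a<N. w i a * cnj (w j a))"
  using assms
proof (induction S arbitrary: A rule: finite_induct)
  case empty
  then show ?case by auto
next
  case (insert x S)
  have fin: "finite (insert x S)" using insert.hyps by simp
  let ?B = "kernel_at A x"
  have "psd S ?B"
    by (rule psd_subset[OF fin _ psd_schur_complement[OF fin insert.prems]]) auto
  then obtain N :: nat and w where N: "1 \<le> N" and w: "\<And>i j. i \<in> S \<Longrightarrow> j \<in> S \<Longrightarrow> ?B i j = (\<Sum>a<N. w i a * cnj (w j a))"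
    using insert.IH[of ?B] by blast
  define r where "r = Re (A x x)"
  have r: "0 \<le> r" "A x x = complex_of_real r"
    using psd_diag_nonneg[OF fin insert.prems, of x]
    by (auto simp: r_def less_eq_complex_def complex_eq_iff)
  \<comment> \<open>if \<open>r = 0\<close>, the column of \<open>x\<close> vanishes and the division by zero yields the right value\<close>
  define v where "v i a = (if a < N then (if i = x then 0 else w i a) else A i x / sqrt r)" for i a
  have herm: "A x j = cnj (A j x)" if "j \<in> insert x S" for j
    using psd_hermitian[OF fin insert.prems that, of x] by simp
  have B0: "?B x j = 0 \<and> ?B j x = 0" if "j \<in> insert x S" for j
    using psd_diag_zero[OF fin insert.prems, of x j] herm[OF that] that
    by (auto simp: kernel_at_def)
  have last: "A i x / sqrt r * cnj (A j x / sqrt r) = A i x * A x j / A x x" if "j \<in> insert x S" for i j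
    using r herm[OF that] by (simp flip: of_real_mult)
  have "A i j = (\<Sum>a<Suc N. v i a * cnj (v j a))" if ij: "i \<in> insert x S" "j \<in> insert x S" for i j
  proof -
    have "(\<Sum>a<N. v i a * cnj (v j a)) = ?B i j"
    proof (cases "i = x \<or> j = x")
      case True
      then show ?thesis using ij B0 by (auto simp: v_def)
    next
      case False
      then show ?thesis using ij w[of i j] by (simp add: v_def)
    qed
    moreover have "v i N * cnj (v j N) = A i x * A x j / A x x"
      using last[OF ij(2)] by (simp add: v_def)
    ultimately show ?thesis by (simp add: kernel_at_def)
  qed
  then show ?case by (intro exI[of _ "Suc N"] conjI exI[of _ v] ballI) simp_all
qed

lemma psd_block_diagonal:
  assumes "finite S" "T \<subseteq> S" "psd T A" "psd (S - T) A"
    and "\<And>x y. x \<in> T \<Longrightarrow> y \<in> S - T \<Longrightarrow> A x y = 0 \<and> A y x = 0"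
  shows "psd S A"
  unfolding psd_def
proof
  fix c
  have split: "sum F S = sum F T + sum F (S - T)" for F :: "'a \<Rightarrow> complex"
    using sum.subset_diff[OF assms(2,1)] by (simp add: add.commute)
  have "(\<Sum>i\<in>S. \<Sum>j\<in>S. cnj (c i) * A i j * c j) =
     (\<Sum>i\<in>T. \<Sum>j\<in>T. cnj (c i) * A i j * c j) + (\<Sum>i\<in>S-T. \<Sum>j\<in>S-T. cnj (c i) * A i j * c j)"
    unfolding split using assms(5) by simp
  then show "0 \<le> (\<Sum>i\<in>S. \<Sum>j\<in>S. cnj (c i) * A i j * c j)"
    using psdD[OF assms(3), of c] psdD[OF assms(4), of c] by simp
qed


section \<open>Row multipliers and interpolation\<close>

context hilbert_function_space
begin

lemma ip_add_right: "f \<in> H \<Longrightarrow> g \<in> H \<Longrightarrow> u \<in> H \<Longrightarrow> ip u (\<lambda>x. f x + g x) = ip u f + ip u g"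
  using ip_add[of f g u] ip_cnj[of f u] ip_cnj[of g u] ip_cnj[of "\<lambda>x. f x + g x" u] add_mem
  by simp

lemma ip_scale_right: "f \<in> H \<Longrightarrow> u \<in> H \<Longrightarrow> ip u (\<lambda>x. c * f x) = cnj c * ip u f"
  using ip_scale[of f u c] ip_cnj[of f u] ip_cnj[of "\<lambda>x. c * f x" u] scale_mem
  by simp

lemma ip_zero_right: "u \<in> H \<Longrightarrow> ip u (\<lambda>x. 0) = 0"
  using ip_scale_right[OF zero_mem, of u 0] by simp

lemma sum_mem: "finite S \<Longrightarrow> (\<And>i. i \<in> S \<Longrightarrow> f i \<in> H) \<Longrightarrow> (\<lambda>x. \<Sum>i\<in>S. c i * f i x) \<in> H"
  by (induction S rule: finite_induct) (simp_all add: zero_mem add_mem scale_mem)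

lemma ip_sum_right:
  assumes "finite S" "\<And>i. i \<in> S \<Longrightarrow> f i \<in> H" "u \<in> H"
  shows "ip u (\<lambda>x. \<Sum>i\<in>S. c i * f i x) = (\<Sum>i\<in>S. cnj (c i) * ip u (f i))"
  using assms
proof (induction S rule: finite_induct)
  case (insert i S)
  then show ?case
    by (simp add: ip_add_right ip_scale_right scale_mem sum_mem)
qed (simp add: ip_zero_right)

lemma ip_self: "f \<in> H \<Longrightarrow> ip f f = complex_of_real ((ip_norm ip f)\<^sup>2)"
  using ip_nonneg[of f] by (simp add: ip_norm_def less_eq_complex_def complex_eq_iff)

text \<open>This is positivity of the norm of \<open>f - g\<close>. It replaces Cauchy--Schwarz below.\<close>

lemma twice_ip_le:
  assumes "f \<in> H" "g \<in> H"
  shows "2 * Re (ip f g) \<le> (ip_norm ip f)\<^sup>2 + (ip_norm ip g)\<^sup>2"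
proof -
  let ?g = "\<lambda>x. - 1 * g x"
  have g: "?g \<in> H" by (rule scale_mem[OF assms(2)])
  then have m: "(\<lambda>x. f x + ?g x) \<in> H" by (rule add_mem[OF assms(1)])
  have "ip (\<lambda>x. f x + ?g x) (\<lambda>x. f x + ?g x) = ip f f - ip f g - (ip g f - ip g g)"
    using ip_add[OF assms(1) g m] ip_scale[OF assms(2) m, of "-1"]
      ip_add_right[OF assms(1) g assms(1)] ip_add_right[OF assms(1) g assms(2)]
      ip_scale_right[OF assms(2) assms(1), of "-1"] ip_scale_right[OF assms(2) assms(2), of "-1"]
    by simp
  with ip_nonneg[OF m] have "0 \<le> ip f f - ip f g - (ip g f - ip g g)" by simp
  then show ?thesis
    using ip_self[OF assms(1)] ip_self[OF assms(2)] ip_cnj[OF assms]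
    by (simp add: less_eq_complex_def)
qed

end

text \<open>The first row \<open>\<phi>\<close> of \<open>\<Phi>\<close> is a contractive multiplier into \<open>H\<close>, and its adjoint maps the kernel
  function \<open>k\<^sub>z\<close> to the column with entries \<open>cnj (\<phi> z a) k\<^sub>z\<close>. The quadratic form of the
  statement at \<open>c\<close> is therefore the squared norm of \<open>u = \<Sum>z. c z k\<^sub>z\<close> minus that of its image
  \<open>f\<close> under the adjoint. No adjoint has to be constructed: with \<open>G = \<phi> f\<close> and \<open>Q\<close> the squared
  norm of \<open>f\<close>, the reproducing property gives \<open>\<langle>G, u\<rangle> = Q\<close>, and
  \<open>2 Q \<le> \<parallel>G\<parallel>\<^sup>2 + \<parallel>u\<parallel>\<^sup>2 \<le> Q + \<parallel>u\<parallel>\<^sup>2\<close>.\<close>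

lemma contractive_multiplier_row_psd:
  assumes mult: "contractive_multiplier X s N \<Phi>" and N: "1 \<le> N"
    and S: "finite S" "S \<subseteq> X"
  shows "psd S (\<lambda>x y. s x y * (1 - (\<Sum>a<N. \<Phi> x $$ (0, a) * cnj (\<Phi> y $$ (0, a)))))"
  unfolding psd_def
proof
  fix c :: "'a \<Rightarrow> complex"
  from mult obtain H ip where rkhs: "is_rkhs X s H ip"
    and contr: "\<And>F. F \<in> vec_space N H \<Longrightarrow> multiply X N \<Phi> F \<in> vec_space N H \<and>
           vec_norm N ip (multiply X N \<Phi> F) \<le> vec_norm N ip F"
    and carr: "\<And>x. x \<in> X \<Longrightarrow> \<Phi> x \<in> carrier_mat N N"
    unfolding contractive_multiplier_def by blast
  interpret hilbert_function_space X H ip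
    using rkhs by (simp add: is_rkhs_def)
  let ?k = "kernel_section X s"
  have k: "?k z \<in> H" and rep: "f \<in> H \<Longrightarrow> ip f (?k z) = f z" if "z \<in> X" for z f
    using rkhs that by (auto simp: is_rkhs_def)
  have kS: "z \<in> S \<Longrightarrow> ?k z \<in> H" for z using k S by blast
  let ?q = "\<lambda>d. \<Sum>x\<in>S. \<Sum>y\<in>S. cnj (d x) * s x y * d y"
  have comb: "(\<lambda>x. \<Sum>z\<in>S. d z * ?k z x) \<in> H" for d
    by (rule sum_mem[OF S(1) kS])
  have ip_comb: "ip f (\<lambda>x. \<Sum>z\<in>S. d z * ?k z x) = (\<Sum>x\<in>S. cnj (d x) * f x)" if "f \<in> H" for f and d :: "'a \<Rightarrow> complex"
    using ip_sum_right[OF S(1) kS that, where c = d] rep[OF _ that] S by (simp add: subset_iff)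
  have norm_comb: "complex_of_real ((ip_norm ip (\<lambda>x. \<Sum>z\<in>S. d z * ?k z x))\<^sup>2) = ?q d" for d
    unfolding ip_self[OF comb, symmetric] ip_comb[OF comb] using S
    by (intro sum.cong) (auto simp: kernel_section_def sum_distrib_left subset_iff mult_ac)
  define e where "e a z = cnj (\<Phi> z $$ (0, a)) * c z" for a z
  define f where "f a = (\<lambda>x. \<Sum>z\<in>S. e a z * ?k z x)" for a
  define u where "u = (\<lambda>x. \<Sum>z\<in>S. c z * ?k z x)"
  define F where "F x = vec N (\<lambda>a. f a x)" for x
  define Q where "Q = (\<Sum>a<N. (ip_norm ip (f a))\<^sup>2)"
  have FH: "F \<in> vec_space N H"
    unfolding vec_space_def F_def using comb by (auto simp: f_def)
  define G where "G = (\<lambda>x. multiply X N \<Phi> F x $ 0)"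
  have GH: "G \<in> H" using contr[OF FH] N by (auto simp: vec_space_def G_def)
  have "(ip_norm ip G)\<^sup>2 \<le> (\<Sum>i<N. (ip_norm ip (\<lambda>x. multiply X N \<Phi> F x $ i))\<^sup>2)"
    unfolding G_def by (rule member_le_sum) (use N in auto)
  also have "\<dots> \<le> (\<Sum>i<N. (ip_norm ip (\<lambda>x. F x $ i))\<^sup>2)"
    using contr[OF FH] by (simp add: vec_norm_def)
  also have "\<dots> = Q" by (simp add: F_def Q_def)
  finally have GQ: "(ip_norm ip G)\<^sup>2 \<le> Q" .
  have Gx: "G x = (\<Sum>a<N. \<Phi> x $$ (0, a) * f a x)" if "x \<in> X" for x
    using carr[OF that] that N
    by (auto simp: G_def multiply_def F_def scalar_prod_def lessThan_atLeast0 intro!: sum.cong)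
  have "ip G u = (\<Sum>x\<in>S. cnj (c x) * G x)"
    unfolding u_def by (rule ip_comb[OF GH])
  also have "\<dots> = (\<Sum>x\<in>S. \<Sum>a<N. cnj (e a x) * f a x)"
    using S Gx by (intro sum.cong) (auto simp: e_def sum_distrib_left mult_ac)
  also have "\<dots> = (\<Sum>a<N. \<Sum>x\<in>S. cnj (e a x) * f a x)" by (rule sum.swap)
  also have "\<dots> = (\<Sum>a<N. ip (f a) (f a))"
    using ip_comb[OF comb] by (simp add: f_def)
  also have "\<dots> = complex_of_real Q"
    unfolding Q_def using ip_self comb by (simp add: f_def)
  finally have ipQ: "ip G u = complex_of_real Q" .
  have "2 * Q \<le> Q + (ip_norm ip u)\<^sup>2"
    using twice_ip_le[OF GH, of u] GQ comb ipQ by (simp add: u_def)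
  then have "0 \<le> complex_of_real ((ip_norm ip u)\<^sup>2) - complex_of_real Q"
    by (simp add: less_eq_complex_def)
  also have "\<dots> = ?q c - (\<Sum>a<N. ?q (e a))"
    unfolding Q_def u_def f_def by (simp only: of_real_sum norm_comb)
  also have "(\<Sum>a<N. ?q (e a)) = (\<Sum>x\<in>S. \<Sum>y\<in>S. \<Sum>a<N. cnj (e a x) * s x y * e a y)"
    by (subst sum.swap, rule sum.cong[OF refl], rule sum.swap)
  also have "?q c - \<dots> = (\<Sum>x\<in>S. \<Sum>y\<in>S. cnj (c x) *
      (s x y * (1 - (\<Sum>a<N. \<Phi> x $$ (0, a) * cnj (\<Phi> y $$ (0, a))))) * c y)"
    by (simp add: sum_subtractf[symmetric] e_def sum_distrib_left sum_distrib_right right_diff_distrib left_diff_distrib mult_ac)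
  finally show "0 \<le> \<dots>" .
qed

text \<open>Rows are placed into square matrices whose other rows vanish. The Pick matrix then decomposes
  over the position \<open>a\<close> inside the blocks: the part with \<open>a = 0\<close> is the hypothesis, the other
  parts are copies of \<open>s\<close>.\<close>

lemma complete_pick_row_interpolation:
  assumes pick: "complete_pick X s" and S: "finite S" "S \<subseteq> X" "S \<noteq> {}" and N: "1 \<le> N"
    and P: "psd S (\<lambda>x y. s x y * (1 - (\<Sum>a<N. w x a * cnj (w y a))))"
  shows "\<exists>\<phi> :: 'a \<Rightarrow> nat \<Rightarrow> complex.
      (\<forall>x\<in>S. \<forall>a<N. \<phi> x a = w x a) \<and>
      (\<forall>T. finite T \<longrightarrow> T \<subseteq> X \<longrightarrow> psd T (\<lambda>x y. s x y * (1 - (\<Sum>a<N. \<phi> x a * cnj (\<phi> y a)))))"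
proof -
  define n where "n = card S"
  have n: "1 \<le> n" using S by (simp add: n_def Suc_le_eq card_gt_0_iff)
  obtain z where "bij_betw z {0..<card S} S"
    using ex_bij_betw_nat_finite[OF S(1)] by blast
  then have zS: "z ` {..<n} = S" and inj: "inj_on z {..<n}"
    unfolding bij_betw_def atLeast0LessThan n_def by blast+
  have zi: "z i \<in> S" if "i < n" for i using zS that by blast
  define W where "W x = mat N N (\<lambda>(i, a). if i = 0 then w x a else (0::complex))" for x
  have adj: "mat_adjoint (W y) $$ (i, b) = (if b = 0 then cnj (w y i) else 0)"
    if "i < N" "b < N" for y i b
    using that by (simp add: W_def mat_adjoint_def mat_of_rows_index)
  have W_entry: "W y $$ (i, a) = (if i = 0 then w y a else 0)" if "i < N" "a < N" for y i a
    using that by (simp add: W_def)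
  have carr: "W x \<in> carrier_mat N N" "mat_adjoint (W x) \<in> carrier_mat N N" for x
    by (simp_all add: W_def mat_adjoint_def mat_of_rows_def)
  have WW: "(1\<^sub>m N - W x * mat_adjoint (W y)) $$ (a, b)
      = (if a = b then 1 - (if a = 0 then (\<Sum>a<N. w x a * cnj (w y a)) else 0) else 0)"
    if "a < N" "b < N" for x y a b
  proof -
    have "(W x * mat_adjoint (W y)) $$ (a, b) = (\<Sum>i<N. W x $$ (a, i) * mat_adjoint (W y) $$ (i, b))"
      using that carr[of x] carr[of y] by (simp add: scalar_prod_def atLeast0LessThan)
    also have "\<dots> = (if a = 0 \<and> b = 0 then (\<Sum>a<N. w x a * cnj (w y a)) else 0)"
      using that by (auto simp: adj W_entry)
    finally show ?thesis
      using that carr[of x] carr[of y] by auto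
  qed
  define B where "B a x y = (s x y * (1 - (if a = 0 then (\<Sum>a<N. w x a * cnj (w y a)) else 0)))"
    for a :: nat and x y
  have sS: "psd S s"
    using pick S by (simp add: complete_pick_def pd_kernel_iff_finite)
  have "psd {..<n} (\<lambda>i j. B a (z i) (z j))" for a
    by (rule psd_comp, simp, cases "a = 0") (simp_all add: B_def zS P sS)
  then have "psd ({..<n} \<times> {..<N}) (\<lambda>(i, a) (j, b). if a = b then B a (z i) (z j) else 0)"
    by (intro psd_block_sum) auto
  also have "?this \<longleftrightarrow> psd ({..<n} \<times> {..<N})
          (\<lambda>(i, a) (j, b). s (z i) (z j) * (1\<^sub>m N - W (z i) * mat_adjoint (W (z j))) $$ (a, b))"
    by (rule psd_cong) (auto simp: WW B_def)
  finally have "psd ({..<n} \<times> {..<N})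
          (\<lambda>(i, a) (j, b). s (z i) (z j) * (1\<^sub>m N - W (z i) * mat_adjoint (W (z j))) $$ (a, b))" .
  then obtain \<Phi> where mult: "contractive_multiplier X s N \<Phi>" and \<Phi>: "\<And>i. i < n \<Longrightarrow> \<Phi> (z i) = W (z i)"
    using pick[unfolded complete_pick_def, THEN conjunct2, rule_format,
        of n N z "\<lambda>i. W (z i)"] n N zi S(2) carr by auto
  show ?thesis
  proof (intro exI conjI ballI allI impI)
    fix x a assume "x \<in> S" "a < N"
    then show "\<Phi> x $$ (0, a) = w x a"
      using \<Phi> zS by (auto simp: W_def)
  next
    fix T assume "finite T" "T \<subseteq> X"
    then show "psd T (\<lambda>x y. s x y * (1 - (\<Sum>a<N. \<Phi> x $$ (0, a) * cnj (\<Phi> y $$ (0, a)))))"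
      by (rule contractive_multiplier_row_psd[OF mult N])
  qed
qed


text \<open>The operator \<open>u \<mapsto> f\<close> of \<open>contractive_multiplier_row_psd\<close> maps multiples of the kernel
  function of \<open>z\<close> to columns of such multiples, so its compression to the orthogonal complement,
  whose kernel is \<open>s\<^sup>z\<close>, is again a contraction. In terms of matrices: add to the hypothesis the
  positive matrices \<open>\<phi> D \<phi>\<^sup>*\<close> with \<open>D = s - s\<^sup>z\<close>; the conclusion is the Schur complement at
  \<open>z\<close> of the sum \<open>B\<close>.\<close>

lemma kernel_at_row_psd:
  assumes S: "finite S" "z \<in> S" and s: "psd S s" "s z z \<noteq> 0"
    and P: "psd S (\<lambda>x y. s x y * (1 - (\<Sum>a<N. \<phi> x a * cnj (\<phi> y a))))"
  shows "psd S (\<lambda>x y. kernel_at s z x y * (1 - (\<Sum>a<N. \<phi> x a * cnj (\<phi> y a))))"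
proof -
  define C where "C x y = (\<Sum>a<N. \<phi> x a * cnj (\<phi> y a))" for x y
  define D where "D x y = s x z * s z y / s z z" for x y
  have "0 \<le> s z z" by (rule psd_diag_nonneg[OF S(1) s(1) S(2)])
  then obtain \<sigma> where \<sigma>: "s z z = complex_of_real \<sigma>" "0 < \<sigma>"
    using s(2) by (auto simp: less_eq_complex_def complex_eq_iff intro!: that[of "Re (s z z)"])
  have D: "psd S D"
  proof -
    have "psd S (\<lambda>x y. s x z * cnj (s y z) * complex_of_real (1 / \<sigma>))"
      by (intro psd_scale psd_rank_one) (use \<sigma> in simp)
    also have "?this \<longleftrightarrow> psd S D"
      using psd_hermitian[OF S(1) s(1) _ S(2)] \<sigma> by (intro psd_cong) (auto simp: D_def)
    finally show ?thesis .
  qed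
  define B where "B x y = s x y * (1 - C x y) + (\<Sum>a<N. \<phi> x a * D x y * cnj (\<phi> y a))" for x y
  have B: "psd S B"
    unfolding B_def[abs_def] using P[folded C_def] by (intro psd_add psd_sum psd_congruence D)
  have B': "B x y = kernel_at s z x y * (1 - C x y) + D x y" for x y
  proof -
    have "(\<Sum>a<N. \<phi> x a * D x y * cnj (\<phi> y a)) = D x y * C x y"
      by (simp add: C_def sum_distrib_left mult_ac)
    then show ?thesis by (simp add: B_def kernel_at_def D_def algebra_simps diff_divide_distrib)
  qed
  have "kernel_at s z x y * (1 - C x y) = kernel_at B z x y" for x y
    using s(2) by (simp add: kernel_at_def[of B] B') (simp add: kernel_at_def D_def diff_divide_distrib)
  then show ?thesis
    using psd_schur_complement[OF S(1) B S(2)] by (simp add: C_def)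
qed

section \<open>Quotients of a complete Pick kernel\<close>

lemma complete_pick_psd: "complete_pick X s \<Longrightarrow> finite S \<Longrightarrow> S \<subseteq> X \<Longrightarrow> psd S s"
  by (simp add: complete_pick_def pd_kernel_iff_finite)

text \<open>If \<open>s x y = 0\<close>, the values \<open>1\<close> at \<open>x\<close> and \<open>-1\<close> at \<open>y\<close> have the zero Pick matrix, so they can
  be interpolated by a contractive multiplier. By \<open>kernel_at_row_psd\<close> the matrix \<open>s\<^sup>z (1 - w w\<^sup>*)\<close>
  is positive on \<open>{x, y}\<close>; its diagonal vanishes, so its off-diagonal entry
  \<open>- 2 s(x,z) s(z,y) / s(z,z)\<close> vanishes too.\<close>

lemma complete_pick_nonzero_trans:
  assumes pick: "complete_pick X s" and X: "x \<in> X" "y \<in> X" "z \<in> X"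
    and nz: "s z z \<noteq> 0" "s x z \<noteq> 0" "s z y \<noteq> 0"
  shows "s x y \<noteq> 0"
proof
  assume 0: "s x y = 0"
  define w :: "'a \<Rightarrow> nat \<Rightarrow> complex" where "w v a = (if v = x then 1 else -1)" for v a
  have "s y x = 0"
    using psd_hermitian[of "{x, y}" s x y] complete_pick_psd[OF pick, of "{x, y}"] X 0 by simp
  then have R: "psd {x, y} (\<lambda>u v. s u v * (1 - (\<Sum>a<1. w u a * cnj (w v a))))"
    using 0 by (subst psd_cong[where B = "\<lambda>_ _. 0"]) (auto simp: w_def psd_def)
  have xy: "finite {x, y}" "{x, y} \<subseteq> X" "{x, y} \<noteq> {}" "(1::nat) \<le> 1" using X by auto
  obtain \<phi> :: "'a \<Rightarrow> nat \<Rightarrow> complex"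
    where \<phi>: "\<forall>u\<in>{x, y}. \<forall>a<1. \<phi> u a = w u a"
      and P: "\<forall>T. finite T \<longrightarrow> T \<subseteq> X \<longrightarrow> psd T (\<lambda>x y. s x y * (1 - (\<Sum>a<1. \<phi> x a * cnj (\<phi> y a))))"
    using complete_pick_row_interpolation[OF pick xy R] by (elim exE conjE)
  let ?T = "{x, y, z}" and ?K = "\<lambda>u v. kernel_at s z u v * (1 - (\<Sum>a<1. \<phi> u a * cnj (\<phi> v a)))"
  have K: "psd ?T ?K"
    by (rule kernel_at_row_psd[OF _ _ complete_pick_psd[OF pick] nz(1) P[rule_format]]) (use X in auto)
  have "?K x x = 0" using \<phi> by (simp add: w_def)
  then have "?K x y = 0" using psd_diag_zero[OF _ K, of x y] by simp
  moreover have "x \<noteq> y"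
    using psd_diag_zero[of "{x, z}" s x z] complete_pick_psd[OF pick, of "{x, z}"] X 0 nz(2) by auto
  ultimately show False
    using \<phi> 0 nz by (auto simp: w_def kernel_at_def)
qed

text \<open>Positivity is proved for all \<open>z\<close> at once, because the step from smaller sets to \<open>S\<close> uses
  the induction hypothesis with base point \<open>y \<in> S\<close> in order to reach an arbitrary base point
  \<open>z\<close>.\<close>

lemma complete_pick_kernel_quotient:
  assumes pick: "complete_pick X s" and nz: "\<And>x. x \<in> X \<Longrightarrow> s x x \<noteq> 0"
    and "finite S" "S \<subseteq> X" "z \<in> X"
  shows "psd S (\<lambda>x y. kernel_at s z x y / s x y)"
  using assms(3-)
proof (induction S arbitrary: z rule: finite_psubset_induct)
  case (psubset S)
  note S = psubset.hyps psubset.prems(1) and z = psubset.prems(2)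
  have herm: "s v x = cnj (s x v)" if "x \<in> X" "v \<in> X" for x v
    using psd_hermitian[of "{x, v}" s x v] complete_pick_psd[OF pick, of "{x, v}"] that by simp
  have trans: "s x v \<noteq> 0" if "s x y \<noteq> 0" "s y v \<noteq> 0" "x \<in> X" "y \<in> X" "v \<in> X" for x y v
    by (rule complete_pick_nonzero_trans[OF pick that(3,5,4)]) (use nz that in auto)
  show ?case
  proof (cases "S = {}")
    case True
    then show ?thesis by (simp add: psd_def)
  next
    case False
    then obtain y where y: "y \<in> S" by blast
    then have yX: "y \<in> X" using S by blast
    let ?I = "{x \<in> S. s x y \<noteq> 0}"
    show ?thesis
    proof (cases "?I = S")
      \<comment> \<open>\<open>s\<close> vanishes between \<open>?I\<close> and its complement, and both are smaller than \<open>S\<close>\<close>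
      case ne: False
      have yI: "y \<in> ?I" using y nz yX by simp
      show ?thesis
      proof (rule psd_block_diagonal[OF S(1), of ?I])
        show "psd ?I (\<lambda>x y. kernel_at s z x y / s x y)"
          using ne S z by (intro psubset.IH) auto
        show "psd (S - ?I) (\<lambda>x y. kernel_at s z x y / s x y)"
          using yI S z by (intro psubset.IH) blast+
        fix x v assume xv: "x \<in> ?I" "v \<in> S - ?I"
        then have X: "x \<in> X" "v \<in> X" and xy: "s x y \<noteq> 0" and vy: "s v y = 0" using S by auto
        have "s v x = 0" using trans[OF _ xy] vy X yX by blast
        then show "kernel_at s z x v / s x v = 0 \<and> kernel_at s z v x / s v x = 0"
          using herm[OF X(2,1)] by simp
      qed auto
    next
      case True
      then have xy: "s x y \<noteq> 0" if "x \<in> S" for x using that by blast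
      have yx: "s y x \<noteq> 0" if "x \<in> S" for x using xy[OF that] herm[of x y] S that yX by auto
      have xv: "s x v \<noteq> 0" if "x \<in> S" "v \<in> S" for x v
        using trans[OF xy yx] that S yX by blast
      define \<sigma> where "\<sigma> = Re (s y y)"
      have "0 \<le> s y y" by (rule psd_diag_nonneg[OF S(1) complete_pick_psd[OF pick S] y])
      then have \<sigma>: "s y y = complex_of_real \<sigma>" "0 < \<sigma>"
        using xy[OF y] by (auto simp: \<sigma>_def less_eq_complex_def complex_eq_iff)
      let ?A = "\<lambda>x v. kernel_at s y x v / s x v"
      have "psd (S - {y}) ?A"
        using y S yX by (intro psubset.IH) auto
      moreover have ky: "kernel_at s y y v = 0" "kernel_at s y v y = 0" for v
        using nz[OF yX] by (simp_all add: kernel_at_def)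
      moreover have "psd {y} ?A" by (simp add: psd_def ky)
      ultimately have A: "psd S ?A"
        using y by (intro psd_block_diagonal[OF S(1), of "{y}"]) simp_all
      obtain N :: nat and w :: "'a \<Rightarrow> nat \<Rightarrow> complex"
        where N: "1 \<le> N" and w: "\<forall>x\<in>S. \<forall>v\<in>S. ?A x v = (\<Sum>a<N. w x a * cnj (w v a))"
        using psd_gram[OF S(1) A] by (elim exE conjE)
      \<comment> \<open>the rows \<open>w\<close> factor \<open>s\<^sup>y / s\<close>, so their Pick matrix has rank one\<close>
      have ww: "1 - (\<Sum>a<N. w x a * cnj (w v a)) = s x y * s y v / (s y y * s x v)"
        if "x \<in> S" "v \<in> S" for x v
        unfolding w[rule_format, OF that, symmetric] using xv[OF that] xy[OF y]
        by (simp add: kernel_at_def field_simps)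
      have "psd S (\<lambda>x v. s x y * cnj (s v y) * complex_of_real (1 / \<sigma>))"
        by (intro psd_scale psd_rank_one) (use \<sigma> in simp)
      also have "?this \<longleftrightarrow> psd S (\<lambda>x v. s x v * (1 - (\<Sum>a<N. w x a * cnj (w v a))))"
      proof (rule psd_cong)
        fix x v assume that: "x \<in> S" "v \<in> S"
        show "s x y * cnj (s v y) * complex_of_real (1 / \<sigma>) = s x v * (1 - (\<Sum>a<N. w x a * cnj (w v a)))"
          unfolding ww[OF that] using xv[OF that] herm[of v y] that S yX \<sigma> by auto
      qed
      finally have P: "psd S (\<lambda>x v. s x v * (1 - (\<Sum>a<N. w x a * cnj (w v a))))" .
      obtain \<phi> :: "'a \<Rightarrow> nat \<Rightarrow> complex"
        where \<phi>: "\<forall>x\<in>S. \<forall>a<N. \<phi> x a = w x a"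
          and P: "\<forall>T. finite T \<longrightarrow> T \<subseteq> X \<longrightarrow> psd T (\<lambda>x y. s x y * (1 - (\<Sum>a<N. \<phi> x a * cnj (\<phi> y a))))"
        using complete_pick_row_interpolation[OF pick S False N P] by (elim exE conjE)
      let ?K = "\<lambda>x v. kernel_at s z x v * (1 - (\<Sum>a<N. \<phi> x a * cnj (\<phi> v a)))"
      have T: "finite (insert z S)" "insert z S \<subseteq> X" using S z by auto
      have "psd (insert z S) ?K"
        by (rule kernel_at_row_psd[OF T(1) _ complete_pick_psd[OF pick T] nz[OF z] P[rule_format, OF T]]) simp
      then have "psd S ?K" by (rule psd_subset[OF T(1), rotated]) auto
      \<comment> \<open>undo the rank one factor \<open>s(x,y) s(y,v) / s(y,y)\<close>\<close>
      then have "psd S (\<lambda>x v. 1 / s x y * ?K x v * cnj (1 / s v y) * complex_of_real \<sigma>)"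
        using \<sigma> by (intro psd_scale psd_congruence) auto
      also have "?this \<longleftrightarrow> ?thesis"
      proof (rule psd_cong)
        fix x v assume that: "x \<in> S" "v \<in> S"
        have "?K x v = kernel_at s z x v * (s x y * s y v / (s y y * s x v))"
          using that by (simp add: \<phi> ww[symmetric])
        then show "1 / s x y * ?K x v * cnj (1 / s v y) * complex_of_real \<sigma> = kernel_at s z x v / s x v"
          using xv[OF that] xy[OF that(1)] yx[OF that(2)] herm[of v y] that S yX \<sigma> by (auto simp: field_simps)
      qed
      finally show ?thesis .
    qed
  qed
qed

section \<open>From strong certificates to certificates\<close>

text \<open>The matrix equals
  \<open>h\<^sup>z + (h(\<cdot>,z) - t) (h(z,\<cdot>) - t) / (t (1 - t))\<close>, a Schur complement plus a positive matrix of
  rank one. For \<open>t = 0\<close> the row and the column of \<open>z\<close> in \<open>h\<close> vanish, and with \<open>u / 0 = 0\<close> both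
  expressions reduce to \<open>h\<close>.\<close>

lemma kernel_complement_psd:
  assumes S: "finite S" "z \<in> S" and h: "psd S h" "h z z = complex_of_real t" "t < 1"
  shows "psd S (\<lambda>w v. h w v - 1 + (1 - h w z) * (1 - h z v) / (1 - h z z))"
proof -
  have t: "0 \<le> t"
    using psd_diag_nonneg[OF S(1) h(1) S(2)] h(2) by (simp add: less_eq_complex_def)
  have "psd S (\<lambda>w v. kernel_at h z w v
      + (h w z - of_real t) * cnj (h v z - of_real t) * complex_of_real (1 / (t * (1 - t))))"
    using t h(3) by (intro psd_add psd_schur_complement S h(1) psd_scale psd_rank_one) simp
  also have "?this \<longleftrightarrow> ?thesis"
  proof (rule psd_cong)
    fix w v assume wv: "w \<in> S" "v \<in> S"
    have herm: "h z v = cnj (h v z)" by (rule psd_hermitian[OF S(1) h(1) wv(2) S(2)])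
    have t1: "1 - complex_of_real t \<noteq> 0" using h(3) by (auto simp: complex_eq_iff)
    show "kernel_at h z w v + (h w z - of_real t) * cnj (h v z - of_real t) * complex_of_real (1 / (t * (1 - t)))
      = h w v - 1 + (1 - h w z) * (1 - h z v) / (1 - h z z)"
    proof (cases "t = 0")
      case True
      then have z: "h z v = 0" "h z w = 0"
        using psd_diag_zero[OF S(1) h(1) S(2)] h(2) wv by auto
      then have "h w z = 0" using psd_hermitian[OF S(1) h(1) S(2) wv(1)] by simp
      with z True h(2) show ?thesis by (simp add: kernel_at_def)
    next
      case False
      define a b u where "a = h w z" and "b = h z v" and "u = complex_of_real t"
      have u: "u \<noteq> 0" "1 - u \<noteq> 0" using False t1 by (simp_all add: u_def)
      have "(a - u) * (b - u) / (u * (1 - u)) - a * b / u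
          = ((a - u) * (b - u) - a * b * (1 - u)) / (u * (1 - u))"
        using u by (simp add: diff_divide_distrib)
      also have "\<dots> = ((1 - a) * (1 - b) * u - u * (1 - u)) / (u * (1 - u))"
        by (rule arg_cong[where f = "\<lambda>x. x / _"]) (simp add: algebra_simps)
      also have "\<dots> = (1 - a) * (1 - b) / (1 - u) - 1"
        using u by (simp add: diff_divide_distrib)
      finally have "h w v - a * b / u + (a - u) * (b - u) / (u * (1 - u))
          = h w v - 1 + (1 - a) * (1 - b) / (1 - u)" by (simp add: algebra_simps)
      then show ?thesis
        by (simp add: kernel_at_def h(2) herm a_def b_def u_def)
    qed
  qed
  finally show ?thesis .
qed

theorem proposition3p3:
  fixes X :: "'a set"
    and k l :: "'a \<Rightarrow> 'a \<Rightarrow> complex"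
  assumes "X \<noteq> {}"
    and "pd_kernel X k"
    and "pd_kernel X l"
    and "\<forall>x\<in>X. k x x \<noteq> 0 \<and> l x x \<noteq> 0"
    and "\<exists>s. strong_shimorin_certificate X k l s"
  shows "\<exists>p. shimorin_certificate X k l p"
proof -
  from assms(5) obtain s h g where pick: "complete_pick X s"
    and h: "pd_kernel X h" and g: "pd_kernel X g"
    and k: "\<And>w v. w \<in> X \<Longrightarrow> v \<in> X \<Longrightarrow> k w v = (1 - h w v) * s w v"
    and l: "\<And>w v. w \<in> X \<Longrightarrow> v \<in> X \<Longrightarrow> l w v = s w v * g w v"
    unfolding strong_shimorin_certificate_def by blast
  have nz: "s x x \<noteq> 0" "g x x \<noteq> 0" "1 - h x x \<noteq> 0" if "x \<in> X" for x
    using assms(4) that k[OF that that] l[OF that that] by auto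
  define p where "p z w v = kernel_at s z w v / s w v" for z w v
  \<comment> \<open>where \<open>s w v = 0\<close>, also \<open>s w z * s z v = 0\<close>, so the division by zero does no harm\<close>
  have ps: "p z w v * s w v = kernel_at s z w v" if "z \<in> X" "w \<in> X" "v \<in> X" for z w v
    using complete_pick_nonzero_trans[OF pick that(2,3,1) nz(1)[OF that(1)]]
    by (auto simp: p_def kernel_at_def)
  have "pd_kernel X (p z) \<and> kernel_le X (\<lambda>w v. p z w v * l w v) (kernel_at l z)
      \<and> kernel_le X (kernel_at k z) (\<lambda>w v. p z w v * k w v)" if z: "z \<in> X" for z
  proof -
    define \<sigma> where "\<sigma> = Re (s z z)"
    have Z: "finite {z}" "{z} \<subseteq> X" using z by auto
    have "0 \<le> s z z"
      using psd_diag_nonneg[OF Z(1) complete_pick_psd[OF pick Z]] by simp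
    then have \<sigma>: "s z z = complex_of_real \<sigma>" "0 < \<sigma>"
      using nz(1)[OF z] by (auto simp: \<sigma>_def less_eq_complex_def complex_eq_iff)
    have "psd {z} h" "psd {z} k"
      using pd_kernel_psd[OF h Z] pd_kernel_psd[OF assms(2) Z] by blast+
    then have "0 \<le> h z z" "0 \<le> k z z" using psd_diag_nonneg[OF Z(1)] by auto
    then obtain t where t: "h z z = complex_of_real t" "t < 1"
      using k[OF z z] nz(3)[OF z] \<sigma>
      by (intro that[of "Re (h z z)"]) (auto simp: less_eq_complex_def complex_eq_iff zero_le_mult_iff)
    have "psd S (p z)"
        "psd S (\<lambda>w v. kernel_at l z w v - p z w v * l w v)"
        "psd S (\<lambda>w v. p z w v * k w v - kernel_at k z w v)" if S: "finite S" "S \<subseteq> X" for S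
    proof -
      define T where "T = insert z S"
      have T: "finite T" "T \<subseteq> X" "z \<in> T" "S \<subseteq> T" using S z by (auto simp: T_def)
      have herm: "s z v = cnj (s v z)" if "v \<in> S" for v
        using psd_hermitian[OF T(1) complete_pick_psd[OF pick T(1,2)], of v z] T that by auto
      show "psd S (p z)"
        using complete_pick_kernel_quotient[OF pick nz(1) S z] by (simp add: p_def[abs_def])
      have gh: "psd T g" "psd T h"
        using pd_kernel_psd[OF g T(1,2)] pd_kernel_psd[OF h T(1,2)] by blast+
      \<comment> \<open>both differences of kernels have this rank one factor\<close>
      have fac: "psd S (\<lambda>w v. s w z * s z v / s z z * B w v)" if "psd T B" for B
      proof -
        have "psd S (\<lambda>w v. s w z * B w v * cnj (s v z) * complex_of_real (1 / \<sigma>))"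
          using \<sigma> by (intro psd_scale psd_congruence psd_subset[OF T(1,4) that]) simp
        also have "?this \<longleftrightarrow> psd S (\<lambda>w v. s w z * s z v / s z z * B w v)"
          using herm \<sigma> by (intro psd_cong) auto
        finally show ?thesis .
      qed
      have "psd S (\<lambda>w v. s w z * s z v / s z z * kernel_at g z w v)"
        by (intro fac psd_schur_complement T gh)
      also have "?this \<longleftrightarrow> psd S (\<lambda>w v. kernel_at l z w v - p z w v * l w v)"
      proof (rule psd_cong)
        fix w v assume wv: "w \<in> S" "v \<in> S"
        then have X: "w \<in> X" "v \<in> X" using S by auto
        have pl: "p z w v * l w v = kernel_at s z w v * g w v"
          using ps[OF z X] l[OF X] by (simp flip: mult.assoc)
        have lz: "l w z * l z v / l z z = s w z * s z v / s z z * (g w z * g z v / g z z)"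
          using X z by (simp add: l mult_ac)
        show "s w z * s z v / s z z * kernel_at g z w v = kernel_at l z w v - p z w v * l w v"
          unfolding pl kernel_at_def[of l] lz
          unfolding kernel_at_def l[OF X] by (simp add: algebra_simps)
      qed
      finally show "psd S (\<lambda>w v. kernel_at l z w v - p z w v * l w v)" .
      have "psd S (\<lambda>w v. s w z * s z v / s z z * (h w v - 1 + (1 - h w z) * (1 - h z v) / (1 - h z z)))"
        by (intro fac kernel_complement_psd[OF T(1,3) gh(2) t])
      also have "?this \<longleftrightarrow> psd S (\<lambda>w v. p z w v * k w v - kernel_at k z w v)"
      proof (rule psd_cong)
        fix w v assume wv: "w \<in> S" "v \<in> S"
        then have X: "w \<in> X" "v \<in> X" using S by auto
        have pk: "p z w v * k w v = kernel_at s z w v * (1 - h w v)"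
          using ps[OF z X] k[OF X] by (simp add: mult_ac flip: mult.assoc)
        have kz: "k w z * k z v / k z z
            = s w z * s z v / s z z * ((1 - h w z) * (1 - h z v) / (1 - h z z))"
          using X z by (simp add: k mult_ac)
        show "s w z * s z v / s z z * (h w v - 1 + (1 - h w z) * (1 - h z v) / (1 - h z z))
            = p z w v * k w v - kernel_at k z w v"
          unfolding pk kernel_at_def[of k] kz
          unfolding kernel_at_def k[OF X] by (simp add: algebra_simps diff_divide_distrib)
      qed
      finally show "psd S (\<lambda>w v. p z w v * k w v - kernel_at k z w v)" .
    qed
    then show ?thesis
      unfolding pd_kernel_iff_finite kernel_le_def by (intro conjI allI impI)
  qed
  then show ?thesis
    unfolding shimorin_certificate_def by blast
qed

end
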